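(* Let $h_1,h_2:\mathbb R_+\to\mathbb R$ be continuous increasing functions with $h_i(0)\le0$, satisfying $$\lim_{t\to\infty}\frac{h_i(t)}t=\infty\quad\text{and}\quad\limsup_{t\to\infty}\frac{h_i(t+1)}{h_i(t)}<\infty,\qquad i=1,2,$$ and such that $$\liminf_{t\to\infty}\bigl(h_1(t)-h_2(t)\bigr)>\limsup_{t\to\infty}\frac{\ln h_1(t)}t+\limsup_{t\to\infty}\frac{\omega_t(1;h_1^{-1})}{h_1^{-1}(t)}.$$ Then all entire functions of the form $c_1f_{h_1}+c_2f_{h_2}$, $(c_1,c_2)\in\mathbb C^2\setminus\{(0,0)\}$, are of class $\mathscr C$.
   Context: $\mathbb R_+=[0,\infty)$, $\mathbb Z_+=\{0,1,2,\dots\}$. "Increasing" means strictly increasing, and $h^{-1}:[h(0),\infty)\to[0,\infty)$ is the inverse function of $h$. For such $h$, $f_h$ denotes an entire function $f_h(z)=\sum_{j=0}^\infty c_jz^j$ on $\mathbb C$ with $\ln|c_j|=-\int_0^jh^{-1}(s)\,ds$, $j\in\mathbb Z_+$ (the arguments of the $c_j$ are arbitrary). For $t\ge0$, $\omega_t(\cdot\,;g)$ is the modulus of continuity of $g|_{[0,t]}$: $\omega_t(\delta;g)=\sup\{|g(x)-g(y)|:x,y\in[0,t],\ |x-y|\le\delta\}$. For an entire function $f$ on $\mathbb C^n$: $M_f(r):=\sup_{\|z\|<r}|f(z)|$ ($\|\cdot\|$ the Euclidean norm), $m_f(r):=\ln M_f(r)$, the order is $\rho_f:=\limsup_{r\to\infty}\frac{\ln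 m_f(r)}{\ln r}$, and $\phi_f(t):=m_f(e^t)$, $t\in\mathbb R$. Class $\mathscr C$ consists of the nonpolynomial entire functions $f$ satisfying one of the following: (I) $\rho_f<\infty$ and $\limsup_{t\to\infty}\frac{\phi_f(t+1)-\phi_f(t)}{\phi_f(t)-\phi_f(t-1)}<\infty$; (II) $\rho_f=\infty$ and $\lim_{t\to\infty}t^2\left(\frac1{\ln\psi(t)}\right)'=0$ (limit over the points where $\psi'$ exists) for some convex increasing $\psi\in C(\mathbb R)$ with $\lim_{t\to\infty}\frac{\ln\psi(t)}{\ln\phi_f(t)}=1$. *)

theory Defs
  imports "HOL-Analysis.Analysis" "HOL-Computational_Algebra.Polynomial"
begin

text \<open>
  Functions on \<open>[0,\<infinity>)\<close> are functions on all reals whose values at negative arguments are never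
  used. In particular the inverse \<open>[h(0),\<infinity>) \<rightarrow> [0,\<infinity>)\<close> of \<open>h\<close> is \<open>inv_into {0..} h\<close>.
\<close>

definition modulus_of_continuity :: "real \<Rightarrow> real \<Rightarrow> (real \<Rightarrow> real) \<Rightarrow> real" where
  "modulus_of_continuity t \<delta> g =
     Sup {\<bar>g x - g y\<bar> | x y. x \<in> {0..t} \<and> y \<in> {0..t} \<and> \<bar>x - y\<bar> \<le> \<delta>}"

text \<open>
  \<open>is_f h f\<close>: the function \<open>f\<close> is one of the entire functions \<open>f_h\<close>; the arguments of the
  coefficients are arbitrary. Since \<open>ln 0 = 0\<close> in HOL, \<open>c j \<noteq> 0\<close> has to be required explicitly.
\<close>

definition is_f :: "(real \<Rightarrow> real) \<Rightarrow> (complex \<Rightarrow> complex) \<Rightarrow> bool" where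
  "is_f h f \<longleftrightarrow>
     (\<exists>c :: nat \<Rightarrow> complex.
        (\<forall>j. c j \<noteq> 0 \<and> ln (norm (c j)) = - integral {0..real j} (inv_into {0..} h)) \<and>
        (\<forall>z. (\<lambda>j. c j * z ^ j) sums f z))"

definition max_modulus :: "('a::real_normed_vector \<Rightarrow> complex) \<Rightarrow> real \<Rightarrow> real" where
  "max_modulus f r = (SUP z\<in>ball 0 r. norm (f z))"

definition log_max_modulus :: "('a::real_normed_vector \<Rightarrow> complex) \<Rightarrow> real \<Rightarrow> real" where
  "log_max_modulus f r = ln (max_modulus f r)"

definition growth_order :: "('a::real_normed_vector \<Rightarrow> complex) \<Rightarrow> ereal" where
  "growth_order f = Limsup at_top (\<lambda>r. ereal (ln (log_max_modulus f r) / ln r))"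

definition growth_phi :: "('a::real_normed_vector \<Rightarrow> complex) \<Rightarrow> real \<Rightarrow> real" where
  "growth_phi f t = log_max_modulus f (exp t)"

definition class_C_I :: "('a::real_normed_vector \<Rightarrow> complex) \<Rightarrow> bool" where
  "class_C_I f \<longleftrightarrow>
     growth_order f < \<infinity> \<and>
     Limsup at_top (\<lambda>t. ereal ((growth_phi f (t + 1) - growth_phi f t) /
                               (growth_phi f t - growth_phi f (t - 1)))) < \<infinity>"

text \<open>
  The limit of \<open>t\<^sup>2 (1 / ln \<psi>(t))'\<close> is taken along the points \<open>t\<close> at which \<open>\<psi>'\<close> exists.
\<close>

definition class_C_II :: "('a::real_normed_vector \<Rightarrow> complex) \<Rightarrow> bool" where
  "class_C_II f \<longleftrightarrow>
     growth_order f = \<infinity> \<and>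
     (\<exists>\<psi> :: real \<Rightarrow> real.
        continuous_on UNIV \<psi> \<and> convex_on UNIV \<psi> \<and> strict_mono \<psi> \<and>
        ((\<lambda>t. ln (\<psi> t) / ln (growth_phi f t)) \<longlongrightarrow> 1) at_top \<and>
        ((\<lambda>t. t\<^sup>2 * deriv (\<lambda>s. 1 / ln (\<psi> s)) t) \<longlongrightarrow> 0)
          (inf at_top (principal {t. \<psi> differentiable (at t)})))"

text \<open>The class of functions of one complex variable.\<close>

definition class_C :: "(complex \<Rightarrow> complex) set" where
  "class_C = {f. f holomorphic_on UNIV \<and> \<not> (\<exists>p. f = poly p) \<and> (class_C_I f \<or> class_C_II f)}"

end

theory Submission
  imports Defs "HOL-Complex_Analysis.Complex_Analysis"
begin

text \<open>
  The combination always falls under case (I). Put \<open>g = h\<^sup>-\<^sup>1\<close>, \<open>H(s) = \<integral>\<^sub>0\<^sup>s g\<close> and let \<open>\<Phi>\<close> be the Legendre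
  transform of the convex function \<open>H\<close>, so that \<open>\<Phi>\<close> has slope \<open>h\<close>. If \<open>|a\<^sub>j|\<close> is comparable to
  \<open>exp (- H j)\<close>, then Cauchy's estimate for the coefficient with index \<open>\<lfloor>h t\<rfloor>\<close> and summation of a
  geometric series give \<open>\<Phi>(t) - t - B \<le> \<phi>\<^sub>f(t) \<le> \<Phi>(t + 1/2) + B\<close>. As \<open>t = o(h(t))\<close>, the quotient of
  consecutive increments of \<open>\<phi>\<^sub>f\<close> is at most \<open>8 h(t + 3/2) / h(t - 1/2)\<close> for large \<open>t\<close>, which is
  bounded. The bound on \<open>h(t + 1) / h(t)\<close> also makes \<open>h\<close> at most exponential, so the order is finite.

  If \<open>c\<^sub>1 \<noteq> 0\<close>, the coefficients of \<open>f\<^sub>1\<close> dominate: eventually \<open>h\<^sub>1 - h\<^sub>2 \<ge> d > 0\<close>, that is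
  \<open>g\<^sub>1(s + d) \<le> g\<^sub>2(s)\<close>, and integrating gives \<open>H\<^sub>2(s) \<ge> H\<^sub>1(s) + d g\<^sub>1(s) + const\<close>.
\<close>

section \<open>Entire power series: Taylor coefficients and the maximum modulus\<close>

lemma entire_power_series_has_fps_expansion:
  fixes a :: "nat \<Rightarrow> complex"
  assumes "\<And>z. (\<lambda>j. a j * z ^ j) sums f z"
  shows "f has_fps_expansion Abs_fps a"
proof -
  have "fps_conv_radius (Abs_fps a) = \<infinity>"
    unfolding fps_conv_radius_def using assms
    by (intro conv_radius_inftyI'') (auto simp: sums_iff)
  moreover have "eval_fps (Abs_fps a) z = f z" for z
    using assms[of z] by (simp add: eval_fps_def sums_iff)
  ultimately show ?thesis
    by (auto simp: has_fps_expansion_def)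
qed

lemma entire_power_series_holomorphic:
  fixes a :: "nat \<Rightarrow> complex"
  assumes "\<And>z. (\<lambda>j. a j * z ^ j) sums f z"
  shows "f holomorphic_on A"
proof -
  have "f field_differentiable at z" for z
  proof -
    have "f holomorphic_on ball 0 (norm z + 1)"
      using assms by (intro power_series_holomorphic[where a = a]) simp
    then show ?thesis
      by (simp add: holomorphic_on_imp_differentiable_at)
  qed
  then show ?thesis
    using field_differentiable_at_within holomorphic_on_def by blast
qed

lemma power_series_not_polynomial:
  fixes a :: "nat \<Rightarrow> complex"
  assumes f: "\<And>z. (\<lambda>j. a j * z ^ j) sums f z" and nz: "\<exists>\<^sub>\<infinity>j. a j \<noteq> 0"
  shows "f \<noteq> poly p"
proof
  assume "f = poly p"
  then have "f has_fps_expansion fps_of_poly p"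
    by (simp add: has_fps_expansion_def)
  with entire_power_series_has_fps_expansion[OF f] have "Abs_fps a = fps_of_poly p"
    using fps_expansion_unique_complex by blast
  then have "a j = coeff p j" for j
    by (metis fps_nth_Abs_fps fps_of_poly_nth)
  with nz have "\<exists>\<^sub>\<infinity>j. coeff p j \<noteq> 0" by simp
  then show False
    using MOST_coeff_eq_0[of p] by (simp add: frequently_def)
qed

lemma norm_le_max_modulus:
  fixes f :: "complex \<Rightarrow> complex"
  assumes "continuous_on UNIV f" "norm z < r"
  shows "norm (f z) \<le> max_modulus f r"
proof -
  have "continuous_on (cball 0 r) (\<lambda>z. norm (f z))"
    using assms(1) by (intro continuous_intros) (auto intro: continuous_on_subset)
  then have "bdd_above ((\<lambda>z. norm (f z)) ` cball 0 r)"
    by (simp add: compact_continuous_image compact_imp_bounded bounded_imp_bdd_above)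
  then have "bdd_above ((\<lambda>z. norm (f z)) ` ball 0 r)"
    by (rule bdd_above_mono) auto
  then show ?thesis
    unfolding max_modulus_def using assms(2) by (intro cSUP_upper) auto
qed

text \<open>\<open>max_modulus\<close> is a supremum over an open ball, so Cauchy's inequality is
  applied on circles of radius \<open>x < r\<close>, and \<open>x\<close> then tends to
  \<open>r\<close> from the left.\<close>

lemma coeff_le_max_modulus:
  fixes a :: "nat \<Rightarrow> complex"
  assumes f: "\<And>z. (\<lambda>j. a j * z ^ j) sums f z" and "0 < r"
  shows "norm (a j) * r ^ j \<le> max_modulus f r"
proof (rule tendsto_upperbound)
  show "((\<lambda>x. norm (a j) * x ^ j) \<longlongrightarrow> norm (a j) * r ^ j) (at_left r)"
    by (intro tendsto_intros)
  have le: "norm (a j) * x ^ j \<le> max_modulus f r" if "0 < x" "x < r" for x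
  proof -
    have "norm ((deriv ^^ j) f 0) \<le> fact j * max_modulus f r / x ^ j"
    proof (rule Cauchy_inequality)
      show "continuous_on (cball 0 x) f"
        by (intro holomorphic_on_imp_continuous_on entire_power_series_holomorphic[OF f])
      fix z :: complex assume "norm (0 - z) = x"
      then show "norm (f z) \<le> max_modulus f r" using that
        by (intro norm_le_max_modulus holomorphic_on_imp_continuous_on
            entire_power_series_holomorphic[OF f]) auto
    qed (use that entire_power_series_holomorphic[OF f] in auto)
    moreover have "norm (a j) = norm ((deriv ^^ j) f 0) / fact j"
      using fps_nth_fps_expansion[OF entire_power_series_has_fps_expansion[OF f], of j]
      by (simp add: norm_divide)
    ultimately have "fact j * norm (a j) \<le> fact j * (max_modulus f r / x ^ j)"
      by simp
    then have "norm (a j) \<le> max_modulus f r / x ^ j"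
      by (rule mult_left_le_imp_le) simp
    then show ?thesis
      using that by (simp add: field_simps)
  qed
  show "\<forall>\<^sub>F x in at_left r. norm (a j) * x ^ j \<le> max_modulus f r"
    using eventually_at_left_real[OF \<open>0 < r\<close>] by eventually_elim (use le in auto)
qed simp

lemma max_modulus_le:
  fixes f :: "complex \<Rightarrow> complex"
  assumes "0 < r" "\<And>z. norm z < r \<Longrightarrow> norm (f z) \<le> B"
  shows "max_modulus f r \<le> B"
  unfolding max_modulus_def using assms by (intro cSUP_least) auto

section \<open>The inverse \<open>g\<close> of \<open>h\<close>, its primitive \<open>H\<close> and
  convexity estimates\<close>

locale growth_function =
  fixes h :: "real \<Rightarrow> real"
  assumes continuous: "continuous_on {0..} h"
    and strict_mono: "strict_mono_on {0..} h"
    and nonpos_at_0: "h 0 \<le> 0"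
    and superlinear: "filterlim (\<lambda>t. h t / t) at_top at_top"
begin

definition "g = inv_into {0..} h"

definition "H s = integral {0..s} g"

text \<open>The Legendre transform of \<open>H\<close>, in terms of the point \<open>h t\<close> at which the supremum
  of \<open>s * t - H s\<close> is attained.\<close>

definition "\<Phi> t = t * h t - H (h t)"

lemma h_less_iff: "0 \<le> s \<Longrightarrow> 0 \<le> t \<Longrightarrow> h s < h t \<longleftrightarrow> s < t"
  using strict_mono strict_mono_on_less[of "{0..}" h s t] by simp

lemma h_le_iff: "0 \<le> s \<Longrightarrow> 0 \<le> t \<Longrightarrow> h s \<le> h t \<longleftrightarrow> s \<le> t"
  using h_less_iff[of t s] by (simp flip: not_less)

lemma g_h: "0 \<le> t \<Longrightarrow> g (h t) = t"
  unfolding g_def using strict_mono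
  by (intro inv_into_f_f strict_mono_on_imp_inj_on) auto

lemma eventually_linear_le: "\<forall>\<^sub>F t in at_top. c * t + d \<le> h t"
proof -
  have "\<forall>\<^sub>F t in at_top. c + \<bar>d\<bar> \<le> h t / t"
    using superlinear by (simp add: filterlim_at_top)
  with eventually_ge_at_top[of 1] show ?thesis
  proof eventually_elim
    case (elim t)
    then have "(c + \<bar>d\<bar>) * t \<le> h t" by (simp add: field_simps)
    moreover have "\<bar>d\<bar> * 1 \<le> \<bar>d\<bar> * t" using elim by (intro mult_left_mono) auto
    ultimately show ?case by (simp add: algebra_simps)
  qed
qed

lemma filterlim_h: "filterlim h at_top at_top"
  unfolding filterlim_at_top using eventually_linear_le[of 0] by simp

text \<open>Intermediate value theorem, with unboundedness of \<open>h\<close> providing the right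
  endpoint. As \<open>h 0 \<le> 0\<close>, this makes \<open>g\<close> a genuine inverse on all of
  \<open>[0,\<infinity>)\<close>.\<close>

lemma obtain_h_eq:
  assumes "h 0 \<le> s"
  obtains t where "0 \<le> t" "h t = s"
proof -
  have "\<forall>\<^sub>F t in at_top. s \<le> h t \<and> 0 \<le> t"
    using filterlim_h eventually_ge_at_top[of 0] by (auto simp: filterlim_at_top eventually_conj)
  then obtain b where "s \<le> h b" "0 \<le> b"
    by (auto simp: eventually_at_top_linorder)
  moreover have "continuous_on {0..b} h"
    using continuous by (rule continuous_on_subset) auto
  ultimately obtain t where "0 \<le> t" "t \<le> b" "h t = s"
    using IVT'[of h 0 s b] assms by auto
  then show thesis by (intro that)
qed

lemma h_g: "0 \<le> s \<Longrightarrow> h (g s) = s"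
  and g_nonneg: "0 \<le> s \<Longrightarrow> 0 \<le> g s"
  using obtain_h_eq[of s] nonpos_at_0 g_h by (smt (verit))+

lemma g_mono: "0 \<le> s \<Longrightarrow> s \<le> s' \<Longrightarrow> g s \<le> g s'"
  using h_le_iff[of "g s" "g s'"] h_g[of s] h_g[of s'] g_nonneg[of s] g_nonneg[of s'] by simp

lemma g_le_iff: "0 \<le> s \<Longrightarrow> 0 \<le> t \<Longrightarrow> g s \<le> t \<longleftrightarrow> s \<le> h t"
  using h_le_iff[of "g s" t] h_g[of s] g_nonneg[of s] by simp

lemma filterlim_g: "filterlim g at_top at_top"
  unfolding filterlim_at_top
proof
  fix b
  show "\<forall>\<^sub>F s in at_top. b \<le> g s"
    using eventually_ge_at_top[of "max 0 (h \<bar>b\<bar>)"]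
  proof eventually_elim
    case (elim s)
    then have "\<bar>b\<bar> \<le> g s"
      using h_le_iff[of "\<bar>b\<bar>" "g s"] h_g[of s] g_nonneg[of s] by simp
    then show ?case by simp
  qed
qed

lemma g_integrable: "0 \<le> u \<Longrightarrow> g integrable_on {u..s}"
  by (intro integrable_on_mono_on mono_onI g_mono) auto

lemma H_diff: "0 \<le> u \<Longrightarrow> u \<le> s \<Longrightarrow> H s - H u = integral {u..s} g"
  unfolding H_def using Henstock_Kurzweil_Integration.integral_combine[of 0 u s g] g_integrable
  by simp

text \<open>Convexity of \<open>H\<close> without derivatives: its increment is an integral of the
  monotone \<open>g\<close>, hence lies between the endpoint slopes times the length.\<close>

lemma H_diff_bounds:
  assumes "0 \<le> u" "u \<le> s"
  shows "g u * (s - u) \<le> H s - H u" "H s - H u \<le> g s * (s - u)"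
proof -
  have "integral {u..s} (\<lambda>_. g u) \<le> integral {u..s} g"
    using assms g_mono by (intro integral_le g_integrable) auto
  then show "g u * (s - u) \<le> H s - H u" using assms by (simp add: H_diff mult.commute)
  have "integral {u..s} g \<le> integral {u..s} (\<lambda>_. g s)"
    using assms g_mono by (intro integral_le g_integrable) auto
  then show "H s - H u \<le> g s * (s - u)" using assms by (simp add: H_diff mult.commute)
qed

lemma H_mono: "0 \<le> u \<Longrightarrow> u \<le> s \<Longrightarrow> H u \<le> H s"
  using H_diff_bounds(1)[of u s] g_nonneg[of u]
  by (smt (verit) mult_nonneg_nonneg)

lemma H_nonneg: "0 \<le> s \<Longrightarrow> 0 \<le> H s"
  using H_mono[of 0 s] by (simp add: H_def)

section \<open>Legendre duality and two-sided bounds for \<open>growth_phi\<close>\<close>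

lemma Young: "0 \<le> s \<Longrightarrow> 0 \<le> t \<Longrightarrow> 0 \<le> h t \<Longrightarrow> s * t - H s \<le> \<Phi> t"
  using H_diff_bounds(1)[of "h t" s] H_diff_bounds(2)[of s "h t"] g_h[of t]
  by (cases "h t \<le> s") (auto simp: \<Phi>_def algebra_simps)

text \<open>\<open>h t\<close> is a subgradient of \<open>\<Phi>\<close> at \<open>t\<close>. The
  sign of \<open>t' - t\<close> is free, so the inequality bounds increments of
  \<open>\<Phi>\<close> from below and, with the points exchanged, from above.\<close>

lemma \<Phi>_diff_ge:
  "0 \<le> t \<Longrightarrow> 0 \<le> t' \<Longrightarrow> 0 \<le> h t \<Longrightarrow> 0 \<le> h t' \<Longrightarrow> h t * (t' - t) \<le> \<Phi> t' - \<Phi> t"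
  using Young[of "h t" t'] by (simp add: \<Phi>_def algebra_simps)

text \<open>The maximizer \<open>h t\<close> has to be rounded to an index of a coefficient.
  Rounding down loses at most \<open>1\<close> in the factor of \<open>t\<close>, and does not
  increase \<open>H\<close>.\<close>

lemma \<Phi>_le_floor:
  assumes "0 \<le> t" "0 \<le> h t"
  shows "\<Phi> t - t \<le> real (nat \<lfloor>h t\<rfloor>) * t - H (real (nat \<lfloor>h t\<rfloor>))"
proof -
  let ?j = "real (nat \<lfloor>h t\<rfloor>)"
  have j: "?j \<le> h t" "h t - ?j \<le> 1" using assms by linarith+
  then have "(h t - ?j) * t \<le> 1 * t" "H ?j \<le> H (h t)"
    using assms by (intro mult_right_mono H_mono; simp)+
  then show ?thesis by (simp add: \<Phi>_def algebra_simps)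
qed

lemma growth_phi_bounds:
  fixes a :: "nat \<Rightarrow> complex"
  assumes f: "\<And>z. (\<lambda>j. a j * z ^ j) sums f z"
    and upper: "\<And>j. norm (a j) \<le> K * exp (- H (real j))"
    and lower: "\<forall>\<^sub>F j in sequentially. k * exp (- H (real j)) \<le> norm (a j)" and "0 < k"
  obtains B where "\<forall>\<^sub>F t in at_top. \<Phi> t - t - B \<le> growth_phi f t \<and>
                                     growth_phi f t \<le> \<Phi> (t + 1/2) + B"
proof -
  \<comment> \<open>Using \<open>Young\<close> at \<open>t + 1/2\<close> instead of \<open>t\<close>
    leaves a spare factor \<open>exp (- j/2) = q ^ j\<close>, which makes the dominating series
    geometric.\<close>
  define q :: real where "q = exp (- (1/2))"
  have q: "0 < q" "q < 1" by (auto simp: q_def)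
  have "0 \<le> K" using order_trans[OF norm_ge_zero upper[of 0]] by (simp add: zero_le_mult_iff)
  \<comment> \<open>The two entries serve the lower and the upper bound. \<open>K + 1\<close> in
    place of \<open>K\<close> gives a positive argument of \<open>ln\<close> from
    \<open>0 \<le> K\<close> alone.\<close>
  define B where "B = max (- ln k) (ln ((K + 1) / (1 - q)))"
  have "\<forall>\<^sub>F t in at_top. k * exp (- H (real (nat \<lfloor>h t\<rfloor>))) \<le> norm (a (nat \<lfloor>h t\<rfloor>))"
    using lower by (rule eventually_compose_filterlim)
      (intro filterlim_compose[OF filterlim_nat_sequentially] filterlim_compose[OF filterlim_floor_sequentially] filterlim_h)
  moreover have "\<forall>\<^sub>F t in at_top. 0 \<le> h t" using filterlim_h by (simp add: filterlim_at_top)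
  ultimately have "\<forall>\<^sub>F t in at_top. \<Phi> t - t - B \<le> growth_phi f t \<and>
                                  growth_phi f t \<le> \<Phi> (t + 1/2) + B"
    using eventually_ge_at_top[of 0]
  proof eventually_elim
    case (elim t)
    let ?j = "nat \<lfloor>h t\<rfloor>" and ?M = "max_modulus f (exp t)"
    have "k * exp (\<Phi> t - t) \<le> k * exp (real ?j * t - H (real ?j))"
      using \<Phi>_le_floor elim \<open>0 < k\<close> by simp
    also have "\<dots> = k * exp (- H (real ?j)) * exp t ^ ?j"
      by (simp add: exp_diff exp_minus field_simps flip: exp_of_nat_mult)
    also have "\<dots> \<le> norm (a ?j) * exp t ^ ?j"
      using elim by (intro mult_right_mono) auto
    also have "\<dots> \<le> ?M" by (rule coeff_le_max_modulus[OF f]) simp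
    finally have le_M: "k * exp (\<Phi> t - t) \<le> ?M" .
    moreover have "0 < k * exp (\<Phi> t - t)" using \<open>0 < k\<close> by simp
    ultimately have "0 < ?M" by linarith
    have "ln (k * exp (\<Phi> t - t)) \<le> growth_phi f t"
      unfolding growth_phi_def log_max_modulus_def
      using \<open>0 < k\<close> le_M \<open>0 < ?M\<close> by (subst ln_le_cancel_iff) auto
    then have 1: "\<Phi> t - t - B \<le> growth_phi f t"
      using \<open>0 < k\<close> by (simp add: ln_mult B_def)
    let ?E = "exp (\<Phi> (t + 1/2))"
    have ht: "0 \<le> h (t + 1/2)" using h_le_iff[of t "t + 1/2"] elim by simp
    have "norm (f z) \<le> (K + 1) * ?E * (1 / (1 - q))" if "norm z < exp t" for z
    proof -
      have le: "norm (a j * z ^ j) \<le> (K + 1) * ?E * q ^ j" for j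
      proof -
        have "norm (a j * z ^ j) \<le> (K * exp (- H (real j))) * exp t ^ j"
          unfolding norm_mult norm_power using upper[of j] that
          by (intro mult_mono power_mono order.trans[OF norm_ge_zero upper[of j]]) auto
        also have "\<dots> = K * (exp (real j * (t + 1/2) - H (real j)) * q ^ j)"
          by (simp add: q_def field_simps flip: exp_of_nat_mult exp_add)
        also have "\<dots> \<le> K * (?E * q ^ j)"
          using Young[of "real j" "t + 1/2"] elim ht q \<open>0 \<le> K\<close>
          by (intro mult_left_mono mult_right_mono) auto
        also have "\<dots> \<le> (K + 1) * (?E * q ^ j)"
          using q by (intro mult_right_mono) auto
        finally show ?thesis by (simp add: mult.assoc)
      qed
      have geo: "(\<lambda>j. (K + 1) * ?E * q ^ j) sums ((K + 1) * ?E * (1 / (1 - q)))"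
        using q by (intro sums_mult geometric_sums) auto
      have "norm (\<Sum>j. a j * z ^ j) \<le> (\<Sum>j. (K + 1) * ?E * q ^ j)"
        using geo le by (intro norm_suminf_le) (auto simp: sums_iff)
      then show ?thesis using geo f[of z] by (simp add: sums_iff)
    qed
    then have "?M \<le> (K + 1) * ?E * (1 / (1 - q))"
      by (intro max_modulus_le) auto
    then have "growth_phi f t \<le> ln ((K + 1) / (1 - q) * ?E)"
      unfolding growth_phi_def log_max_modulus_def using \<open>0 < ?M\<close> by simp
    also have "\<dots> = ln ((K + 1) / (1 - q)) + \<Phi> (t + 1/2)"
      using q \<open>0 \<le> K\<close> by (subst ln_mult) auto
    finally show ?case using 1 by (auto simp: B_def)
  qed
  then show thesis by (rule that)
qed

section \<open>Exponential growth of \<open>h\<close>, finite order and membership in the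
  class\<close>

lemma exponential_bound:
  assumes "\<forall>\<^sub>F t in at_top. h (t + 1) \<le> C * h t"
  obtains c where "0 \<le> c" "\<forall>\<^sub>F t in at_top. h t \<le> exp (c * t)"
proof -
  have "\<forall>\<^sub>F t in at_top. h (t + 1) \<le> C * h t \<and> 1 \<le> h t \<and> 0 \<le> t"
    using filterlim_h
    by (intro eventually_conj assms eventually_ge_at_top) (simp add: filterlim_at_top)
  then obtain T where T: "\<And>t. T \<le> t \<Longrightarrow> h (t + 1) \<le> C * h t \<and> 1 \<le> h t \<and> 0 \<le> t"
    by (auto simp: eventually_at_top_linorder)
  have "0 \<le> T" using T by auto
  \<comment> \<open>The maximum with \<open>1\<close> gives \<open>0 \<le> c\<close>, so that
    \<open>exp (c * real n)\<close> may later be enlarged to \<open>exp (c * t)\<close>.\<close>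
  define c where "c = ln (max C 1)"
  have "0 \<le> c" by (simp add: c_def)
  have step: "h (t + 1) \<le> exp c * h t" if "T \<le> t" for t
  proof -
    have "C * h t \<le> exp c * h t" using T[OF that] by (intro mult_right_mono) (auto simp: c_def)
    then show ?thesis using T[OF that] by linarith
  qed
  have iter: "h (t + real n) \<le> exp (c * real n) * h t" if "T \<le> t" for t n
  proof (induction n)
    case (Suc n)
    have "h (t + real (Suc n)) \<le> exp c * h (t + real n)"
      using step[of "t + real n"] that by (simp add: add_ac)
    also have "\<dots> \<le> exp c * (exp (c * real n) * h t)"
      using Suc by simp
    finally show ?case by (simp add: algebra_simps exp_add)
  qed simp
  \<comment> \<open>The extra \<open>1\<close> in the exponent pays for the constant
    \<open>h (T + 1)\<close>, which is at most \<open>t\<close> and hence at most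
    \<open>exp t\<close>.\<close>
  have "\<forall>\<^sub>F t in at_top. h t \<le> exp ((c + 1) * t)"
    using eventually_ge_at_top[of "max T (h (T + 1))"]
  proof eventually_elim
    case (elim t)
    \<comment> \<open>This many unit steps lead from \<open>t\<close> back into
      \<open>[T, T + 1]\<close>.\<close>
    define n where "n = nat \<lfloor>t - T\<rfloor>"
    have n: "T \<le> t - real n" "t - real n \<le> T + 1" "real n \<le> t"
      using elim \<open>0 \<le> T\<close> unfolding n_def by linarith+
    have "h t \<le> exp (c * real n) * h (t - real n)"
      using iter[of "t - real n" n] n by simp
    also have "\<dots> \<le> exp (c * t) * h (T + 1)"
      using n \<open>0 \<le> c\<close> \<open>0 \<le> T\<close> h_le_iff[of "t - real n" "T + 1"] T[of "t - real n"]
      by (intro mult_mono) (auto intro: mult_left_mono order.trans[OF zero_le_one])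
    also have "\<dots> \<le> exp (c * t) * exp t"
      using elim order.trans[OF _ exp_ge_add_one_self, of "h (T + 1)" t]
      by (intro mult_left_mono) auto
    finally show ?case by (simp add: algebra_simps exp_add)
  qed
  then show thesis using \<open>0 \<le> c\<close> by (intro that[of "c + 1"]) auto
qed

text \<open>Since \<open>H\<close> is nonnegative, \<open>\<Phi> t\<close> is at most
  \<open>t * h t\<close>. The rate of \<open>h\<close> grows by \<open>2\<close> because the
  remaining factor \<open>2 * t\<close> is absorbed by \<open>exp t * exp t\<close>.\<close>

lemma \<Phi>_le_exp:
  assumes "\<forall>\<^sub>F t in at_top. h (t + 1) \<le> C * h t"
  obtains c where "0 \<le> c" "\<forall>\<^sub>F t in at_top. \<Phi> t + B \<le> exp (c * t)"
proof -
  obtain c where c: "0 \<le> c" "\<forall>\<^sub>F t in at_top. h t \<le> exp (c * t)"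
    using exponential_bound[OF assms] .
  have "\<forall>\<^sub>F t in at_top. 0 \<le> h t" using filterlim_h by (simp add: filterlim_at_top)
  with c(2) have "\<forall>\<^sub>F t in at_top. \<Phi> t + B \<le> exp ((c + 2) * t)"
    using eventually_ge_at_top[of "max 1 B"]
  proof eventually_elim
    case (elim t)
    have t: "t + 1 \<le> exp t" by (subst add.commute) (rule exp_ge_add_one_self)
    have "\<Phi> t + B \<le> t * h t + t"
      using elim H_nonneg[of "h t"] by (simp add: \<Phi>_def)
    also have "\<dots> \<le> t * exp (c * t) + exp (c * t) * t"
      using elim \<open>0 \<le> c\<close> mult_right_mono[of 1 "exp (c * t)" t] by (intro add_mono mult_left_mono) auto
    also have "\<dots> = exp (c * t) * (2 * t)" by simp
    also have "\<dots> \<le> exp (c * t) * (exp t * exp t)"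
    proof (rule mult_left_mono)
      have "2 * t \<le> (t + 1) * (t + 1)" by (simp add: algebra_simps)
      also have "\<dots> \<le> exp t * exp t" using t elim by (intro mult_mono) auto
      finally show "2 * t \<le> exp t * exp t" .
    qed simp
    finally show ?case by (simp add: algebra_simps flip: exp_add)
  qed
  then show thesis using c(1) by (intro that[of "c + 2"]) auto
qed

lemma power_series_in_class_C:
  fixes a :: "nat \<Rightarrow> complex"
  assumes ratio: "\<forall>\<^sub>F t in at_top. h (t + 1) \<le> C * h t"
    and f: "\<And>z. (\<lambda>j. a j * z ^ j) sums f z"
    and upper: "\<And>j. norm (a j) \<le> K * exp (- H (real j))"
    and lower: "\<forall>\<^sub>F j in sequentially. k * exp (- H (real j)) \<le> norm (a j)" and "0 < k"
  shows "f \<in> class_C"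
proof -
  let ?\<phi> = "growth_phi f"
  obtain B where B: "\<forall>\<^sub>F t in at_top. \<Phi> t - t - B \<le> ?\<phi> t \<and> ?\<phi> t \<le> \<Phi> (t + 1/2) + B"
    using growth_phi_bounds[OF f upper lower \<open>0 < k\<close>] by blast
  \<comment> \<open>The linear bound is chosen for use at \<open>t - 1/2\<close>, where it reads
    \<open>4 * t + 8 * \<bar>B\<bar> \<le> h (t - 1/2)\<close>: the error \<open>t + 2 * B\<close>
    is then at most a quarter of \<open>h (t - 1/2)\<close>.\<close>
  have "\<forall>\<^sub>F t in at_top. (\<Phi> t - t - B \<le> ?\<phi> t \<and> ?\<phi> t \<le> \<Phi> (t + 1/2) + B) \<and>
      h (t + 1) \<le> C * h t \<and> 4 * t + (2 + 8 * \<bar>B\<bar>) \<le> h t \<and> 1 \<le> t"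
    by (intro eventually_conj B ratio eventually_linear_le eventually_ge_at_top)
  then obtain T where T: "\<And>t. T \<le> t \<Longrightarrow> (\<Phi> t - t - B \<le> ?\<phi> t \<and> ?\<phi> t \<le> \<Phi> (t + 1/2) + B) \<and>
      h (t + 1) \<le> C * h t \<and> 4 * t + (2 + 8 * \<bar>B\<bar>) \<le> h t \<and> 1 \<le> t"
    by (auto simp: eventually_at_top_linorder)
  have pos: "1 \<le> t" "1 \<le> h t" if "T \<le> t" for t using T[OF that] by auto
  \<comment> \<open>Both \<open>h T\<close> and \<open>h (T + 1)\<close> are at least
    \<open>1\<close>, which a negative \<open>C\<close> would contradict.\<close>
  have "0 \<le> C"
    using pos(2)[of T] pos(2)[of "T + 1"] T[of T] by (smt (verit) mult_nonneg_nonneg mult_nonpos_nonneg)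
  have "(?\<phi> (t + 1) - ?\<phi> t) / (?\<phi> t - ?\<phi> (t - 1)) \<le> 8 * C\<^sup>2" if t: "T + 1 \<le> t" for t
  proof -
    \<comment> \<open>The points \<open>t - 1/2\<close> and \<open>t + 3/2\<close> are two unit
      steps apart, whence \<open>C\<^sup>2\<close>.\<close>
    have "h (t + 3/2) \<le> C * h (t + 1/2)" "h (t + 1/2) \<le> C * h (t - 1/2)"
      using T[of "t + 1/2"] T[of "t - 1/2"] t by (auto simp: add.commute add.left_commute)
    with \<open>0 \<le> C\<close> have h: "h (t + 3/2) \<le> C\<^sup>2 * h (t - 1/2)"
      by (smt (verit) mult_left_mono power2_eq_square mult.assoc)
    have small: "4 * t + 8 * \<bar>B\<bar> \<le> h (t - 1/2)" using T[of "t - 1/2"] t by simp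
    have upper: "?\<phi> (t + 1) \<le> \<Phi> (t + 3/2) + B" "?\<phi> (t - 1) \<le> \<Phi> (t - 1/2) + B"
      using T[of "t + 1"] T[of "t - 1"] t by (auto simp: add.commute)
    have lower: "\<Phi> t - t - B \<le> ?\<phi> t" using T[of t] t by simp
    have "h (t - 1/2) \<le> h (t + 3/2)" using pos(1)[of T] t by (subst h_le_iff) auto
    \<comment> \<open>The subgradient at the right end \<open>t + 3/2\<close> bounds the increment
      of \<open>\<Phi>\<close> over length \<open>3/2\<close> from above.\<close>
    moreover have "?\<phi> (t + 1) - ?\<phi> t \<le> 3/2 * h (t + 3/2) + t + 2 * B"
      using upper lower t \<Phi>_diff_ge[of "t + 3/2" t] pos[of t] pos[of "t + 3/2"] by simp
    ultimately have num: "?\<phi> (t + 1) - ?\<phi> t \<le> 2 * h (t + 3/2)"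
      using small pos(1)[of t] t by linarith
    \<comment> \<open>Here the shift by \<open>1/2\<close> in the upper bound still leaves an
      interval of length \<open>1/2\<close>, on which \<open>\<Phi>\<close> has slope at least
      \<open>h (t - 1/2)\<close>.\<close>
    have "h (t - 1/2) / 2 - t - 2 * B \<le> ?\<phi> t - ?\<phi> (t - 1)"
      using upper lower t \<Phi>_diff_ge[of "t - 1/2" t] pos[of t] pos[of "t - 1/2"] by simp
    then have den: "h (t - 1/2) / 4 \<le> ?\<phi> t - ?\<phi> (t - 1)"
      using small by linarith
    have "?\<phi> (t + 1) - ?\<phi> t \<le> 8 * C\<^sup>2 * (h (t - 1/2) / 4)" using num h by simp
    also have "\<dots> \<le> 8 * C\<^sup>2 * (?\<phi> t - ?\<phi> (t - 1))" using den by (intro mult_left_mono) auto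
    finally show ?thesis using den pos(2)[of "t - 1/2"] t by (simp add: pos_divide_le_eq)
  qed
  then have "Limsup at_top (\<lambda>t. ereal ((?\<phi> (t + 1) - ?\<phi> t) / (?\<phi> t - ?\<phi> (t - 1))))
      \<le> ereal (8 * C\<^sup>2)"
    by (intro Limsup_bounded) (auto simp: eventually_at_top_linorder)
  moreover have "growth_order f < \<infinity>"
  proof -
    obtain c where c: "0 \<le> c" "\<forall>\<^sub>F t in at_top. \<Phi> t + B \<le> exp (c * t)"
      using \<Phi>_le_exp[OF ratio] .
    then obtain T' where T': "\<And>t. T' \<le> t \<Longrightarrow> \<Phi> t + B \<le> exp (c * t)"
      by (auto simp: eventually_at_top_linorder)
    have "\<forall>\<^sub>F t in at_top. ln (?\<phi> t) / t \<le> 2 * c"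
      \<comment> \<open>\<open>Young\<close> with \<open>s = 2\<close> gives
        \<open>\<Phi> t - t - B \<ge> t - H 2 - B\<close>, so beyond this threshold
        \<open>growth_phi\<close> is positive and its logarithm can be estimated.\<close>
      using eventually_gt_at_top[of "max (max T T') (H 2 + B)"]
    proof eventually_elim
      case (elim t)
      have "1 \<le> t" using elim pos by simp
      have "0 < ?\<phi> t"
        using Young[of 2 t] T[of t] pos[of t] elim by simp
      have "?\<phi> t \<le> exp (c * (t + 1/2))"
        using T'[of "t + 1/2"] T[of t] elim by auto
      then have "ln (?\<phi> t) \<le> c * (t + 1/2)"
        using ln_mono \<open>0 < ?\<phi> t\<close> by fastforce
      also have "\<dots> \<le> c * (2 * t)" using \<open>0 \<le> c\<close> \<open>1 \<le> t\<close> by (intro mult_left_mono) auto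
      finally show ?case using \<open>1 \<le> t\<close> by (simp add: field_simps)
    qed
    \<comment> \<open>Substituting \<open>t = ln r\<close> turns the bound into one on the quotients
      defining the order.\<close>
    then have "\<forall>\<^sub>F r in at_top. ln (?\<phi> (ln r)) / ln r \<le> 2 * c"
      using ln_at_top by (rule eventually_compose_filterlim)
    with eventually_gt_at_top[of 0]
    have "\<forall>\<^sub>F r in at_top. ereal (ln (log_max_modulus f r) / ln r) \<le> ereal (2 * c)"
      by eventually_elim (simp add: growth_phi_def)
    then have "growth_order f \<le> ereal (2 * c)"
      unfolding growth_order_def by (rule Limsup_bounded)
    then show ?thesis by (rule le_less_trans) simp
  qed
  ultimately have "class_C_I f"
    unfolding class_C_I_def by (auto intro: le_less_trans)
  moreover have "\<forall>\<^sub>F j in sequentially. a j \<noteq> 0"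
    using lower by eventually_elim (use \<open>0 < k\<close> in \<open>auto simp: mult_le_0_iff not_le\<close>)
  then have "\<exists>\<^sub>\<infinity>j. a j \<noteq> 0"
    by (simp add: cofinite_eq_sequentially eventually_frequently)
  ultimately show ?thesis
    unfolding class_C_def
    using entire_power_series_holomorphic[OF f] power_series_not_polynomial[OF f] by simp
qed

section \<open>Coefficients of \<open>f_h\<close> and signs of the two limits superior\<close>

lemma is_f_coefficients:
  assumes "is_f h f"
  obtains c where "\<And>j. norm (c j) = exp (- H (real j))" "\<And>z. (\<lambda>j. c j * z ^ j) sums f z"
proof -
  obtain c where c: "\<And>j. c j \<noteq> 0" "\<And>j. ln (norm (c j)) = - H (real j)"
      "\<And>z. (\<lambda>j. c j * z ^ j) sums f z"
    using assms unfolding is_f_def H_def g_def by auto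
  have "norm (c j) = exp (- H (real j))" for j
    using c(1,2)[of j] by (metis exp_ln zero_less_norm_iff)
  with c(3) show thesis using that by blast
qed

text \<open>Together with \<open>modulus_of_continuity_over_nonneg\<close>, this extracts from the
  main hypothesis that the limit inferior of \<open>h1 - h2\<close> is positive.\<close>

lemma ln_over_nonneg: "0 \<le> Limsup at_top (\<lambda>t. ereal (ln (h t) / t))"
proof (rule order.trans[OF Liminf_bounded Liminf_le_Limsup])
  have "\<forall>\<^sub>F t in at_top. 1 \<le> h t" using filterlim_h by (simp add: filterlim_at_top)
  with eventually_gt_at_top[of 0]
  show "\<forall>\<^sub>F t in at_top. 0 \<le> ereal (ln (h t) / t)"
    by eventually_elim simp
qed simp

lemma modulus_of_continuity_over_nonneg:
  "0 \<le> Limsup at_top (\<lambda>t. ereal (modulus_of_continuity t 1 g / g t))"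
proof (rule order.trans[OF Liminf_bounded Liminf_le_Limsup])
  show "\<forall>\<^sub>F t in at_top. 0 \<le> ereal (modulus_of_continuity t 1 g / g t)"
    using eventually_ge_at_top[of 0]
  proof eventually_elim
    case (elim t)
    let ?S = "{\<bar>g x - g y\<bar> | x y. x \<in> {0..t} \<and> y \<in> {0..t} \<and> \<bar>x - y\<bar> \<le> 1}"
    \<comment> \<open>Without an upper bound, \<open>Sup\<close> would carry no information.
      Monotonicity of \<open>g\<close> supplies the bound \<open>g t\<close>.\<close>
    have "bdd_above ?S"
      using g_mono g_nonneg by (intro bdd_aboveI[of _ "g t"]) (fastforce simp: abs_le_iff)
    moreover have "0 \<in> ?S"
      using elim by (intro CollectI exI[of _ 0]) auto
    ultimately have "0 \<le> modulus_of_continuity t 1 g"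
      unfolding modulus_of_continuity_def by (intro cSup_upper)
    then show ?case using elim g_nonneg by simp
  qed
qed simp

end

section \<open>Comparison of two growth functions and the linear combination\<close>

lemma H_diff_unbounded:
  fixes h1 h2 :: "real \<Rightarrow> real"
  assumes "growth_function h1" "growth_function h2" "0 < d"
    and le: "\<forall>\<^sub>F t in at_top. h2 t + d \<le> h1 t"
  shows "filterlim (\<lambda>s. growth_function.H h2 s - growth_function.H h1 s) at_top at_top"
proof -
  interpret A: growth_function h1 by fact
  interpret B: growth_function h2 by fact
  \<comment> \<open>Setting \<open>t = B.g s\<close> turns the vertical gap \<open>d\<close> between
    \<open>h2\<close> and \<open>h1\<close> into a horizontal shift by \<open>d\<close> between
    their inverses.\<close>
  have "\<forall>\<^sub>F s in at_top. h2 (B.g s) + d \<le> h1 (B.g s)"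
    using le B.filterlim_g by (rule eventually_compose_filterlim)
  with eventually_ge_at_top[of 0]
  have "\<forall>\<^sub>F s in at_top. A.g (s + d) \<le> B.g s"
    by eventually_elim (use \<open>0 < d\<close> in \<open>simp add: A.g_le_iff B.h_g B.g_nonneg\<close>)
  with eventually_ge_at_top[of 0]
  have "\<forall>\<^sub>F s in at_top. 0 \<le> s \<and> A.g (s + d) \<le> B.g s" by (rule eventually_conj)
  then obtain S where S: "\<And>s. S \<le> s \<Longrightarrow> 0 \<le> s \<and> A.g (s + d) \<le> B.g s"
    by (auto simp: eventually_at_top_linorder)
  then have "0 \<le> S" by auto
  have *: "B.H S - A.H (S + d) + d * A.g s \<le> B.H s - A.H s" if "S \<le> s" for s
  proof -
    have "A.g integrable_on {S + d..s + d}"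
      using \<open>0 \<le> S\<close> \<open>0 < d\<close> by (intro A.g_integrable) auto
    then have shift: "((\<lambda>u. A.g (u + d)) has_integral integral {S + d..s + d} A.g) {S..s}"
      using has_integral_shift_real_ivl[of A.g _ "S + d" "s + d" d] by (simp add: has_integral_integral)
    have "A.H (s + d) - A.H (S + d) = integral {S + d..s + d} A.g"
      using \<open>0 \<le> S\<close> \<open>0 < d\<close> that by (intro A.H_diff) auto
    also have "\<dots> \<le> integral {S..s} B.g"
      using has_integral_le[OF shift integrable_integral[OF B.g_integrable]] S \<open>0 \<le> S\<close> by auto
    also have "\<dots> = B.H s - B.H S" using \<open>0 \<le> S\<close> that by (simp add: B.H_diff)
    finally have "A.H (s + d) - A.H (S + d) \<le> B.H s - B.H S" .
    \<comment> \<open>The shift by \<open>d\<close> becomes the additive gain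
      \<open>d * A.g s\<close>, and \<open>A.g\<close> is unbounded.\<close>
    moreover have "A.g s * d \<le> A.H (s + d) - A.H s"
      using A.H_diff_bounds(1)[of s "s + d"] \<open>0 \<le> S\<close> \<open>0 < d\<close> that by simp
    ultimately show ?thesis by (simp add: algebra_simps)
  qed
  have "filterlim (\<lambda>s. B.H S - A.H (S + d) + d * A.g s) at_top at_top"
    by (intro filterlim_tendsto_add_at_top[OF tendsto_const]
        filterlim_tendsto_pos_mult_at_top[OF tendsto_const \<open>0 < d\<close>] A.filterlim_g)
  then show ?thesis
    by (rule filterlim_at_top_mono) (use * in \<open>auto simp: eventually_at_top_linorder\<close>)
qed

lemma Limsup_ratio_bound:
  fixes h :: "real \<Rightarrow> real"
  assumes "Limsup at_top (\<lambda>t. ereal (h (t + 1) / h t)) < \<infinity>" "\<forall>\<^sub>F t in at_top. 0 < h t"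
  obtains C where "\<forall>\<^sub>F t in at_top. h (t + 1) \<le> C * h t"
proof -
  obtain C where "Limsup at_top (\<lambda>t. ereal (h (t + 1) / h t)) < ereal C"
    using ereal_dense2[OF assms(1)] by blast
  then have "\<forall>\<^sub>F t in at_top. ereal (h (t + 1) / h t) < ereal C"
    by (rule Limsup_lessD)
  with assms(2) have "\<forall>\<^sub>F t in at_top. h (t + 1) \<le> C * h t"
    by eventually_elim (simp add: field_simps)
  then show thesis by (rule that)
qed

theorem proposition1p19:
  fixes h1 h2 :: "real \<Rightarrow> real"
  assumes "continuous_on {0..} h1" "continuous_on {0..} h2"
    and "strict_mono_on {0..} h1" "strict_mono_on {0..} h2"
    and "h1 0 \<le> 0" "h2 0 \<le> 0"
    and "filterlim (\<lambda>t. h1 t / t) at_top at_top" "filterlim (\<lambda>t. h2 t / t) at_top at_top"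
    and "Limsup at_top (\<lambda>t. ereal (h1 (t + 1) / h1 t)) < \<infinity>"
    and "Limsup at_top (\<lambda>t. ereal (h2 (t + 1) / h2 t)) < \<infinity>"
    and "Liminf at_top (\<lambda>t. ereal (h1 t - h2 t)) >
           Limsup at_top (\<lambda>t. ereal (ln (h1 t) / t)) +
           Limsup at_top (\<lambda>t. ereal (modulus_of_continuity t 1 (inv_into {0..} h1) /
                                     inv_into {0..} h1 t))"
  shows "\<forall>f1 f2. is_f h1 f1 \<longrightarrow> is_f h2 f2 \<longrightarrow>
           (\<forall>c1 c2 :: complex. (c1, c2) \<noteq> (0, 0) \<longrightarrow> (\<lambda>z. c1 * f1 z + c2 * f2 z) \<in> class_C)"
proof (intro allI impI)
  fix f1 f2 and c1 c2 :: complex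
  assume f: "is_f h1 f1" "is_f h2 f2" and c: "(c1, c2) \<noteq> (0, 0)"
  interpret A: growth_function h1 using assms by unfold_locales
  interpret B: growth_function h2 using assms by unfold_locales
  obtain a where a: "\<And>j. norm (a j) = exp (- A.H (real j))" "\<And>z. (\<lambda>j. a j * z ^ j) sums f1 z"
    using A.is_f_coefficients[OF f(1)] by blast
  obtain b where b: "\<And>j. norm (b j) = exp (- B.H (real j))" "\<And>z. (\<lambda>j. b j * z ^ j) sums f2 z"
    using B.is_f_coefficients[OF f(2)] by blast
  define e where "e j = c1 * a j + c2 * b j" for j
  have sums: "(\<lambda>j. e j * z ^ j) sums (c1 * f1 z + c2 * f2 z)" for z
    using sums_add[OF sums_mult[OF a(2)] sums_mult[OF b(2)], of c1 z c2]
    by (simp add: e_def algebra_simps)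
  show "(\<lambda>z. c1 * f1 z + c2 * f2 z) \<in> class_C"
  proof (cases "c1 = 0")
    case True
    have "\<forall>\<^sub>F t in at_top. 0 < h2 t"
      using B.filterlim_h by (simp add: filterlim_at_top_dense)
    then obtain C where "\<forall>\<^sub>F t in at_top. h2 (t + 1) \<le> C * h2 t"
      using Limsup_ratio_bound assms(10) by blast
    then show ?thesis
      using True c b(1)
      \<comment> \<open>For \<open>c1 = 0\<close> the moduli of the coefficients are exactly
        \<open>norm c2 * exp (- B.H j)\<close>, so one constant serves both bounds.\<close>
      by (intro B.power_series_in_class_C[OF _ sums, of C "norm c2" "norm c2"])
        (auto simp: e_def norm_mult)
  next
    case False
    have "\<forall>\<^sub>F t in at_top. 0 < h1 t"
      using A.filterlim_h by (simp add: filterlim_at_top_dense)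
    then obtain C where C: "\<forall>\<^sub>F t in at_top. h1 (t + 1) \<le> C * h1 t"
      using Limsup_ratio_bound assms(9) by blast
    have "0 < Liminf at_top (\<lambda>t. ereal (h1 t - h2 t))"
      using assms(11) A.ln_over_nonneg A.modulus_of_continuity_over_nonneg
      by (intro le_less_trans[OF _ assms(11)] add_nonneg_nonneg) (auto simp: A.g_def)
    then obtain d where d: "0 < ereal d" "ereal d < Liminf at_top (\<lambda>t. ereal (h1 t - h2 t))"
      using ereal_dense2 by blast
    have "\<forall>\<^sub>F t in at_top. h2 t + d \<le> h1 t"
      using less_LiminfD[OF d(2)] by eventually_elim simp
    then have "filterlim (\<lambda>s. B.H s - A.H s) at_top at_top"
      using d(1) by (intro H_diff_unbounded A.growth_function_axioms B.growth_function_axioms) auto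
    then have lim: "filterlim (\<lambda>j. B.H (real j) - A.H (real j)) at_top sequentially"
      using filterlim_real_sequentially by (rule filterlim_compose)
    \<comment> \<open>This exponential is the quotient
      \<open>norm (b j) / norm (a j)\<close>.\<close>
    have "((\<lambda>j. exp (- (B.H (real j) - A.H (real j)))) \<longlongrightarrow> 0) sequentially"
      by (intro filterlim_compose[OF exp_at_bot] filterlim_compose[OF filterlim_uminus_at_bot_at_top] lim)
    then have "(\<lambda>j. norm c2 * norm (b j) / norm (a j)) \<longlonglongrightarrow> norm c2 * 0"
      unfolding times_divide_eq_right[symmetric]
      by (intro tendsto_mult tendsto_const) (simp add: a b exp_minus exp_diff field_simps)
    then have ratio: "(\<lambda>j. norm c2 * norm (b j) / norm (a j)) \<longlonglongrightarrow> 0" by simp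
    have a_pos: "0 < norm (a j)" for j by (simp add: a)
    \<comment> \<open>The upper bound on coefficients is demanded for every index, so boundedness of
      the whole convergent sequence is used here, not its limit.\<close>
    have "Bseq (\<lambda>j. norm c2 * norm (b j) / norm (a j))"
      using ratio by (intro convergent_imp_Bseq convergentI)
    then obtain K where K: "\<And>j. norm c2 * norm (b j) / norm (a j) \<le> K"
      unfolding Bseq_def by (metis abs_le_D1 real_norm_def)
    show ?thesis
    proof (rule A.power_series_in_class_C[OF C sums])
      fix j
      have "norm (e j) \<le> norm c1 * norm (a j) + norm c2 * norm (b j)"
        unfolding e_def by (metis norm_mult norm_triangle_ineq)
      also have "\<dots> \<le> norm c1 * norm (a j) + K * norm (a j)"
        using K[of j] a_pos[of j] by (simp add: field_simps)
      finally show "norm (e j) \<le> (norm c1 + K) * exp (- A.H (real j))"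
        by (simp add: a algebra_simps)
    next
      \<comment> \<open>Once the second summand is below half of the first, at least
        \<open>norm c1 / 2\<close> times \<open>norm (a j)\<close> survives cancellation.\<close>
      have "\<forall>\<^sub>F j in sequentially. norm c2 * norm (b j) / norm (a j) < norm c1 / 2"
        using ratio False by (intro order_tendstoD) auto
      then show "\<forall>\<^sub>F j in sequentially. norm c1 / 2 * exp (- A.H (real j)) \<le> norm (e j)"
      proof eventually_elim
        case (elim j)
        have "norm c1 * norm (a j) - norm c2 * norm (b j) \<le> norm (e j)"
          unfolding e_def by (metis norm_mult norm_diff_ineq)
        moreover have "norm c2 * norm (b j) \<le> norm c1 / 2 * norm (a j)"
          using elim a_pos[of j] by (simp add: field_simps)
        ultimately show ?case by (simp add: a)
      qed
    qed (use False in simp)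
  qed
qed

end
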